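(* Let $\upsilon\ge1$ be an integer, $q>-1$ and $p$ real, $s\ge0$ an integer with $s<\frac{p-1}{2}$, let $y_1\ne0$ and $y_2$ be real numbers, $w>b$, $t>a$ real, and let $\lambda,\mu\in\mathbb C$ with $\operatorname{Re}(\lambda)>0$, $\operatorname{Re}(\mu)>0$. Then $$\left({}_w\mathbb I_{b^+}^{\lambda}\;{}_t\mathbb I_{a^+}^{\mu}\right)\left((t-a)^{p-s-1}(w-b)^q\;{}_KN_{s;\upsilon}^{(p,q)}\!\left(\frac{1}{y_1(t-a)},\,y_2(w-b)\right)\right)$$ $$=\frac{\Gamma(p-s)}{\Gamma(p+\mu-s)}\,(t-a)^{p+\mu-s-1}(w-b)^{q+\lambda}\;{}_KN_{s;\upsilon}^{(p+\mu,q+\lambda)}\!\left(\frac{1}{y_1(t-a)},\,y_2(w-b)\right).$$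
   Context: $(a)_n$ is the Pochhammer symbol. The first set of finite bivariate biorthogonal N-Konhauser polynomials is $${}_KN_{s;\upsilon}^{(p,q)}(t,w)=\Gamma(p-s)\sum_{k=0}^{s}\sum_{m=0}^{s-k}\frac{(-s)_{k+m}\,t^{s-k}w^{\upsilon m}}{\Gamma(p-2s+k)\,\Gamma(q+1+\upsilon m)\,k!\,m!},$$ the same formula being used for complex parameters. The Riemann–Liouville fractional integral in $w$ is ${}_w\mathbb I_{b^+}^{\kappa}(f)(w)=\frac1{\Gamma(\kappa)}\int_b^w(w-\xi)^{\kappa-1}f(\xi)\,d\xi$ ($\operatorname{Re}(\kappa)>0$, $w>b$); ${}_t\mathbb I_{a^+}^{\mu}$ is the same operator in the variable $t$ with base point $a$. *)

theory Defs
  imports "HOL-Analysis.Analysis"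
begin

text \<open>
  Since \<^term>\<open>Gamma z = 0\<close> at the poles \<open>z\<close> of the Gamma function and \<open>x / 0 = 0\<close>, the factors
  \<open>1 / Gamma z\<close> agree with the entire function \<^const>\<open>rGamma\<close> for all complex parameters.
\<close>

definition KN :: "nat \<Rightarrow> nat \<Rightarrow> complex \<Rightarrow> complex \<Rightarrow> complex \<Rightarrow> complex \<Rightarrow> complex" where
  "KN s \<upsilon> p q t w =
     Gamma (p - of_nat s) *
     (\<Sum>k = 0..s. \<Sum>m = 0..s - k.
        pochhammer (- of_nat s) (k + m) * t ^ (s - k) * w ^ (\<upsilon> * m) /
        (Gamma (p - 2 * of_nat s + of_nat k) * Gamma (q + 1 + of_nat (\<upsilon> * m)) * fact k * fact m))"

definition RL_kernel :: "complex \<Rightarrow> (real \<Rightarrow> complex) \<Rightarrow> real \<Rightarrow> real \<Rightarrow> complex" where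
  "RL_kernel \<kappa> f x \<xi> = of_real (x - \<xi>) powr (\<kappa> - 1) * f \<xi>"

text \<open>
  The Riemann--Liouville integral with base point \<open>b\<close>, as a Lebesgue integral. It is meaningful
  only if \<open>RL_exists\<close> holds; otherwise the library integral is the dummy value \<open>0\<close>.
\<close>

definition RL_exists :: "real \<Rightarrow> complex \<Rightarrow> (real \<Rightarrow> complex) \<Rightarrow> real \<Rightarrow> bool" where
  "RL_exists b \<kappa> f x \<longleftrightarrow> set_integrable lebesgue {b<..<x} (RL_kernel \<kappa> f x)"

definition RL :: "real \<Rightarrow> complex \<Rightarrow> (real \<Rightarrow> complex) \<Rightarrow> real \<Rightarrow> complex" where
  "RL b \<kappa> f x = 1 / Gamma \<kappa> * set_lebesgue_integral lebesgue {b<..<x} (RL_kernel \<kappa> f x)"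

text \<open>The partial operators on functions of two variables \<open>(t, w)\<close>.\<close>

definition RL_t :: "real \<Rightarrow> complex \<Rightarrow> (real \<Rightarrow> real \<Rightarrow> complex) \<Rightarrow> real \<Rightarrow> real \<Rightarrow> complex" where
  "RL_t a \<mu> F t w = RL a \<mu> (\<lambda>\<tau>. F \<tau> w) t"

definition RL_w :: "real \<Rightarrow> complex \<Rightarrow> (real \<Rightarrow> real \<Rightarrow> complex) \<Rightarrow> real \<Rightarrow> real \<Rightarrow> complex" where
  "RL_w b \<kappa> F t w = RL b \<kappa> (\<lambda>\<omega>. F t \<omega>) w"

text \<open>All integrals occurring in \<open>RL_w b \<kappa> (RL_t a \<mu> F) t w\<close> exist.\<close>

definition RL_wt_exists ::
  "real \<Rightarrow> complex \<Rightarrow> real \<Rightarrow> complex \<Rightarrow> (real \<Rightarrow> real \<Rightarrow> complex) \<Rightarrow> real \<Rightarrow> real \<Rightarrow> bool" where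
  "RL_wt_exists b \<kappa> a \<mu> F t w \<longleftrightarrow>
     (\<forall>\<omega>\<in>{b<..<w}. RL_exists a \<mu> (\<lambda>\<tau>. F \<tau> \<omega>) t) \<and>
     RL_exists b \<kappa> (\<lambda>\<omega>. RL_t a \<mu> F t \<omega>) w"

end

theory Submission imports Defs begin

text \<open>
  In the variables \<open>x = t - a\<close> and \<open>y = w - b\<close>, the weight \<open>x\<^bsup>p-s-1\<^esup> y\<^bsup>q\<^esup>\<close> turns the polynomial
  \<^term>\<open>KN s \<upsilon> p q (1 / (y1 * x)) (y2 * y)\<close> into a finite combination of products of powers
  \<open>x\<^bsup>A-1\<^esup> y\<^bsup>B-1\<^esup>\<close> with \<open>A = p - 2s + k\<close> and \<open>B = q + 1 + \<upsilon>m\<close>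
  (\<open>weighted_KN_eq_powr_sum\<close>), and \<open>A\<close> and \<open>B\<close> are exactly the Gamma arguments in the denominator
  of the corresponding coefficient. A Riemann--Liouville integral of order \<open>\<kappa>\<close> sends
  \<open>x\<^bsup>A-1\<^esup> / \<Gamma>(A)\<close> to \<open>x\<^bsup>A+\<kappa>-1\<^esup> / \<Gamma>(A+\<kappa>)\<close> (\<open>has_RL_powr\<close>). Integrating by \<open>\<mu>\<close> in \<open>t\<close> and by \<open>l\<close>
  in \<open>w\<close> therefore just replaces \<open>p\<close> by \<open>p + \<mu>\<close> and \<open>q\<close> by \<open>q + l\<close> in every term, except for the
  outer factor \<open>\<Gamma>(p-s)\<close> of the polynomial, which accounts for the quotient \<open>\<Gamma>(p-s) / \<Gamma>(p+\<mu>-s)\<close>.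
  The hypotheses on \<open>s\<close> and \<open>q\<close> make all the \<open>A\<close> and \<open>B\<close> positive, so that every integral converges
  absolutely.

  The analytic content is the power rule, which is the Beta integral with complex
  exponents (\<open>Beta_integral_complex\<close>). It comes from Fubini's theorem applied
  to \<open>t\<^bsup>\<alpha>-1\<^esup> (u-t)\<^bsup>\<beta>-1\<^esup> e\<^bsup>-u\<^esup>\<close> on \<open>0 < t < u\<close>: integrating over \<open>u\<close> first gives \<open>\<Gamma>(\<alpha>) \<Gamma>(\<beta>)\<close>, while integrating
  over \<open>t\<close> first gives, by scaling, the Beta integral times \<open>\<Gamma>(\<alpha>+\<beta>)\<close>.
\<close>

section \<open>The Beta integral with complex exponents\<close>

text \<open>
  Extending the power by zero to the negative half-line lets the Gamma integral, the Beta integral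
  and the Riemann--Liouville integral of a power be written as integrals over the whole line, where
  translation and scaling need no bookkeeping of the range of integration. The shift of the exponent
  by one makes \<open>z\<close> the parameter of the Gamma function.
\<close>

definition trunc_powr :: "complex \<Rightarrow> real \<Rightarrow> complex" where
  "trunc_powr z x = (if 0 < x then of_real x powr (z - 1) else 0)"

lemma measurable_trunc_powr [measurable]: "trunc_powr z \<in> borel_measurable borel"
proof -
  have "trunc_powr z = (\<lambda>x. if 0 < x then exp ((z - 1) * of_real (ln x)) else 0)"
    by (auto simp: fun_eq_iff trunc_powr_def powr_def Ln_of_real)
  thus ?thesis by simp
qed

lemma norm_trunc_powr: "norm (trunc_powr z x) = indicator {0<..} x * x powr (Re z - 1)"
  by (auto simp: trunc_powr_def norm_powr_real_powr)

lemma trunc_powr_mult: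
  "0 < u \<Longrightarrow> trunc_powr z (u * x) = of_real u powr (z - 1) * trunc_powr z x"
  by (auto simp: trunc_powr_def zero_less_mult_iff powr_times_real)

lemma Gamma_nonzero_if_Re_pos: "Re z > 0 \<Longrightarrow> Gamma z \<noteq> 0" for z :: complex
  by (auto simp: Gamma_eq_zero_iff elim!: nonpos_Ints_cases)

lemma has_bochner_integral_Gamma:
  assumes "Re z > 0"
  shows "has_bochner_integral lborel (\<lambda>x. trunc_powr z x * of_real (exp (- x))) (Gamma z)"
proof -
  let ?f = "\<lambda>t. complex_of_real t powr (z - 1) / of_real (exp t)"
  have eq: "(\<lambda>x. indicator {0<..} x *\<^sub>R ?f x) = (\<lambda>x. trunc_powr z x * of_real (exp (- x)))"
    by (auto simp: fun_eq_iff trunc_powr_def exp_minus divide_inverse)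
  have int: "set_integrable lebesgue {0<..} ?f"
    using absolutely_integrable_Gamma_integral'[OF assms] .
  have "(LINT x:{0<..}|lebesgue. ?f x) = Gamma z"
    using has_integral_unique[OF has_integral_set_lebesgue[OF int] Gamma_integral_complex'[OF assms]] .
  thus ?thesis
    using int unfolding has_bochner_integral_iff set_integrable_def set_lebesgue_integral_def eq
    by (simp add: integrable_completion integral_completion)
qed

text \<open>
  The modulus is a function of the same family with a real parameter, so the absolute integrability
  needed for Fubini's theorem is again a statement about the Gamma integral.
\<close>

lemma norm_trunc_powr_eq: "norm (trunc_powr z x) = Re (trunc_powr (of_real (Re z)) x)"
proof (cases "0 < x")
  case True
  have "complex_of_real x powr (of_real (Re z) - 1) = of_real (x powr (Re z - 1))"
    using True by (simp add: powr_of_real[symmetric])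
  thus ?thesis using True unfolding norm_trunc_powr by (simp add: trunc_powr_def)
qed (simp add: trunc_powr_def)

lemma has_bochner_integral_norm_Gamma:
  assumes "Re z > 0"
  shows "has_bochner_integral lborel (\<lambda>x. norm (trunc_powr z x) * exp (- x)) (Gamma (Re z))"
proof -
  have "has_bochner_integral lborel
     (\<lambda>x. Re (trunc_powr (of_real (Re z)) x * of_real (exp (- x)))) (Re (Gamma (of_real (Re z))))"
    by (intro has_bochner_integral_Re has_bochner_integral_Gamma) (use assms in simp)
  thus ?thesis by (simp add: norm_trunc_powr_eq Gamma_complex_of_real)
qed

lemma trunc_powr_convolution_rescale:
  assumes "0 < u"
  shows "trunc_powr \<alpha> (u * t) * trunc_powr \<beta> (u - u * t) =
           of_real u powr (\<alpha> + \<beta> - 2) * (trunc_powr \<alpha> t * trunc_powr \<beta> (1 - t))"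
proof -
  have "trunc_powr \<beta> (u - u * t) = of_real u powr (\<beta> - 1) * trunc_powr \<beta> (1 - t)"
    using trunc_powr_mult[OF assms, of \<beta> "1 - t"] by (simp add: algebra_simps)
  moreover have "complex_of_real u powr (\<alpha> + \<beta> - 2) = of_real u powr (\<alpha> - 1) * of_real u powr (\<beta> - 1)"
    by (simp add: powr_add[symmetric])
  ultimately show ?thesis
    using trunc_powr_mult[OF assms, of \<alpha> t] by simp
qed

text \<open>
  Scaling reduces the claim to \<open>u = 1\<close>, where the modulus of the integrand is the real Beta integrand
  with parameters \<^term>\<open>Re \<alpha>\<close> and \<^term>\<open>Re \<beta>\<close>.
\<close>

lemma trunc_powr_convolution_integrable:
  assumes "Re \<alpha> > 0" "Re \<beta> > 0"
  shows "integrable lborel (\<lambda>t. trunc_powr \<alpha> t * trunc_powr \<beta> (u - t))"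
proof (cases "0 < u")
  case u: True
  have "set_integrable lborel {0..1} (\<lambda>t. t powr (Re \<alpha> - 1) * (1 - t) powr (Re \<beta> - 1))"
    by (rule integrable_Beta) fact+
  hence "integrable lborel (\<lambda>t. trunc_powr \<alpha> t * trunc_powr \<beta> (1 - t))"
    unfolding set_integrable_def
    by (rule Bochner_Integration.integrable_bound)
       (auto simp: norm_mult norm_trunc_powr indicator_def)
  hence "integrable lborel (\<lambda>t. trunc_powr \<alpha> (0 + u * t) * trunc_powr \<beta> (u - (0 + u * t)))"
    unfolding add_0 trunc_powr_convolution_rescale[OF u] by (rule integrable_mult_right)
  thus ?thesis
    using lborel_integrable_real_affine_iff[of u "\<lambda>t. trunc_powr \<alpha> t * trunc_powr \<beta> (u - t)" 0] u
    by simp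
next
  case False
  hence "(\<lambda>t. trunc_powr \<alpha> t * trunc_powr \<beta> (u - t)) = (\<lambda>_. 0)"
    by (auto simp: trunc_powr_def fun_eq_iff)
  thus ?thesis by simp
qed

text \<open>
  The convolution of two powers is homogeneous in \<open>u\<close>, hence a multiple of a power; the constant,
  which is its value at \<open>u = 1\<close>, is identified afterwards.
\<close>

lemma trunc_powr_convolution_scaling:
  "(\<integral>t. trunc_powr \<alpha> t * trunc_powr \<beta> (u - t) \<partial>lborel) =
     (\<integral>t. trunc_powr \<alpha> t * trunc_powr \<beta> (1 - t) \<partial>lborel) * trunc_powr (\<alpha> + \<beta>) u"
proof (cases "0 < u")
  case u: True
  have "(\<integral>t. trunc_powr \<alpha> t * trunc_powr \<beta> (u - t) \<partial>lborel) =
      u *\<^sub>R (\<integral>t. trunc_powr \<alpha> (u * t) * trunc_powr \<beta> (u - u * t) \<partial>lborel)"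
    using lborel_integral_real_affine[of u "\<lambda>t. trunc_powr \<alpha> t * trunc_powr \<beta> (u - t)" 0] u by simp
  also have "\<dots> = (of_real u * of_real u powr (\<alpha> + \<beta> - 2)) *
      (\<integral>t. trunc_powr \<alpha> t * trunc_powr \<beta> (1 - t) \<partial>lborel)"
    by (simp add: trunc_powr_convolution_rescale[OF u] scaleR_conv_of_real)
  also have "of_real u * of_real u powr (\<alpha> + \<beta> - 2) = trunc_powr (\<alpha> + \<beta>) u"
    using u powr_add[of "complex_of_real u" 1 "\<alpha> + \<beta> - 2"] by (simp add: trunc_powr_def)
  finally show ?thesis by (simp add: mult_ac)
next
  case False
  hence "(\<lambda>t. trunc_powr \<alpha> t * trunc_powr \<beta> (u - t)) = (\<lambda>_. 0)"
    by (auto simp: trunc_powr_def fun_eq_iff)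
  thus ?thesis using False by (simp add: trunc_powr_def)
qed

text \<open>
  Multiplying the convolution by \<open>e\<^bsup>-u\<^esup>\<close> and integrating over \<open>u\<close> yields the constant of
  \<open>trunc_powr_convolution_scaling\<close> times \<open>\<Gamma>(\<alpha>+\<beta>)\<close>. In the other order of integration,
  the translation \<open>u \<mapsto> t + u\<close> separates the variables and yields \<open>\<Gamma>(\<alpha>) \<Gamma>(\<beta>)\<close>.
\<close>

lemma Beta_integral_complex:
  assumes \<alpha>: "Re \<alpha> > 0" and \<beta>: "Re \<beta> > 0"
  shows "(\<integral>t. trunc_powr \<alpha> t * trunc_powr \<beta> (1 - t) \<partial>lborel) = Beta \<alpha> \<beta>"
proof -
  define B where "B = (\<integral>t. trunc_powr \<alpha> t * trunc_powr \<beta> (1 - t) \<partial>lborel)"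
  define g where "g = (\<lambda>t u. trunc_powr \<alpha> t * trunc_powr \<beta> (u - t) * of_real (exp (- u)))"
  have shift: "g t (t + u) = (trunc_powr \<alpha> t * of_real (exp (- t))) *
      (trunc_powr \<beta> u * of_real (exp (- u)))" for t u
    by (simp add: g_def exp_add exp_diff exp_minus divide_inverse)
  have inner: "has_bochner_integral lborel (g t) (trunc_powr \<alpha> t * of_real (exp (- t)) * Gamma \<beta>)" for t
  proof -
    have "has_bochner_integral lborel (\<lambda>u. g t (t + 1 * u)) (trunc_powr \<alpha> t * of_real (exp (- t)) * Gamma \<beta>)"
      unfolding mult_1 shift
      by (intro has_bochner_integral_mult_right has_bochner_integral_Gamma \<beta>)
    thus ?thesis
      by (subst lborel_has_bochner_integral_real_affine_iff[of 1 _ _ t]) simp_all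
  qed
  have inner_norm: "has_bochner_integral lborel (\<lambda>u. norm (g t u))
      (norm (trunc_powr \<alpha> t) * exp (- t) * Gamma (Re \<beta>))" for t
  proof -
    have "has_bochner_integral lborel (\<lambda>u. norm (g t (t + 1 * u)))
        (norm (trunc_powr \<alpha> t) * exp (- t) * Gamma (Re \<beta>))"
      unfolding mult_1 shift norm_mult
      using has_bochner_integral_mult_right[OF has_bochner_integral_norm_Gamma[OF \<beta>],
              of "norm (trunc_powr \<alpha> t) * exp (- t)"]
      by simp
    thus ?thesis
      by (subst lborel_has_bochner_integral_real_affine_iff[of 1 _ _ t]) simp_all
  qed
  have "integrable (lborel \<Otimes>\<^sub>M lborel) (case_prod g)"
  proof (rule lborel_pair.Fubini_integrable)
    show "case_prod g \<in> borel_measurable (lborel \<Otimes>\<^sub>M lborel)"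
      unfolding g_def by measurable
    have "integrable lborel (\<lambda>t. norm (trunc_powr \<alpha> t) * exp (- t) * Gamma (Re \<beta>))"
      using has_bochner_integral_norm_Gamma[OF \<alpha>] by (simp add: has_bochner_integral_iff)
    thus "integrable lborel (\<lambda>t. \<integral>u. norm (case_prod g (t, u)) \<partial>lborel)"
      using inner_norm by (simp add: has_bochner_integral_iff)
    show "AE t in lborel. integrable lborel (\<lambda>u. case_prod g (t, u))"
      using inner by (simp add: has_bochner_integral_iff)
  qed
  hence "(\<integral>u. (\<integral>t. g t u \<partial>lborel) \<partial>lborel) = (\<integral>t. (\<integral>u. g t u \<partial>lborel) \<partial>lborel)"
    by (rule lborel_pair.Fubini_integral)
  also have "\<dots> = Gamma \<alpha> * Gamma \<beta>"
    using inner has_bochner_integral_Gamma[OF \<alpha>] by (simp add: has_bochner_integral_iff)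
  also have "(\<integral>u. (\<integral>t. g t u \<partial>lborel) \<partial>lborel) =
      (\<integral>u. B * (trunc_powr (\<alpha> + \<beta>) u * of_real (exp (- u))) \<partial>lborel)"
  proof (rule arg_cong[where f = "integral\<^sup>L lborel"], rule ext)
    fix u
    have "(\<integral>t. g t u \<partial>lborel) =
        (\<integral>t. trunc_powr \<alpha> t * trunc_powr \<beta> (u - t) \<partial>lborel) * of_real (exp (- u))"
      unfolding g_def by (rule integral_mult_left_zero)
    also have "\<dots> = B * trunc_powr (\<alpha> + \<beta>) u * of_real (exp (- u))"
      unfolding B_def by (rule arg_cong[where f = "\<lambda>z. z * _"], rule trunc_powr_convolution_scaling)
    finally show "(\<integral>t. g t u \<partial>lborel) = B * (trunc_powr (\<alpha> + \<beta>) u * of_real (exp (- u)))"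
      by (simp only: mult.assoc)
  qed
  also have "\<dots> = B * Gamma (\<alpha> + \<beta>)"
    using has_bochner_integral_Gamma[of "\<alpha> + \<beta>"] \<alpha> \<beta> by (simp add: has_bochner_integral_iff)
  finally have "B * Gamma (\<alpha> + \<beta>) = Gamma \<alpha> * Gamma \<beta>" .
  moreover have "Gamma (\<alpha> + \<beta>) \<noteq> 0"
    using \<alpha> \<beta> by (simp add: Gamma_nonzero_if_Re_pos)
  ultimately show ?thesis by (simp add: B_def Beta_def field_simps)
qed

section \<open>Riemann--Liouville integrals of powers\<close>

text \<open>
  Existence and value are bundled in one relation, in the manner of \<^const>\<open>has_integral\<close>, because the
  value alone is not additive when an integral fails to exist.
\<close>

definition has_RL :: "real \<Rightarrow> complex \<Rightarrow> (real \<Rightarrow> complex) \<Rightarrow> real \<Rightarrow> complex \<Rightarrow> bool" where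
  "has_RL b \<kappa> f x v \<longleftrightarrow> RL_exists b \<kappa> f x \<and> RL b \<kappa> f x = v"

lemma has_RL_cong:
  assumes "\<And>\<xi>. b < \<xi> \<Longrightarrow> \<xi> < x \<Longrightarrow> f \<xi> = g \<xi>"
  shows "has_RL b \<kappa> f x v \<longleftrightarrow> has_RL b \<kappa> g x v"
proof -
  have "(\<lambda>\<xi>. indicator {b<..<x} \<xi> *\<^sub>R RL_kernel \<kappa> f x \<xi>) =
      (\<lambda>\<xi>. indicator {b<..<x} \<xi> *\<^sub>R RL_kernel \<kappa> g x \<xi>)"
    using assms by (auto simp: RL_kernel_def indicator_def fun_eq_iff)
  thus ?thesis
    by (simp add: has_RL_def RL_exists_def RL_def set_integrable_def set_lebesgue_integral_def)
qed

lemma has_RL_cmult: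
  assumes "has_RL b \<kappa> f x v"
  shows "has_RL b \<kappa> (\<lambda>\<xi>. c * f \<xi>) x (c * v)"
proof -
  have "RL_kernel \<kappa> (\<lambda>\<xi>. c * f \<xi>) x = (\<lambda>\<xi>. c * RL_kernel \<kappa> f x \<xi>)"
    by (simp add: RL_kernel_def fun_eq_iff)
  thus ?thesis using assms
    by (auto simp: has_RL_def RL_exists_def RL_def)
qed

lemma has_RL_sum:
  assumes "finite I" "\<And>i. i \<in> I \<Longrightarrow> has_RL b \<kappa> (f i) x (v i)"
  shows "has_RL b \<kappa> (\<lambda>\<xi>. \<Sum>i\<in>I. f i \<xi>) x (\<Sum>i\<in>I. v i)"
proof -
  have ker: "RL_kernel \<kappa> (\<lambda>\<xi>. \<Sum>i\<in>I. f i \<xi>) x = (\<lambda>\<xi>. \<Sum>i\<in>I. RL_kernel \<kappa> (f i) x \<xi>)"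
    by (simp add: RL_kernel_def fun_eq_iff sum_distrib_left)
  have "\<And>i. i \<in> I \<Longrightarrow> set_integrable lebesgue {b<..<x} (RL_kernel \<kappa> (f i) x)"
    and "\<And>i. i \<in> I \<Longrightarrow> v i = 1 / Gamma \<kappa> * set_lebesgue_integral lebesgue {b<..<x} (RL_kernel \<kappa> (f i) x)"
    using assms(2) by (auto simp: has_RL_def RL_exists_def RL_def)
  thus ?thesis
    unfolding has_RL_def RL_exists_def RL_def ker set_integrable_def set_lebesgue_integral_def
    by (simp add: scaleR_right.sum sum_distrib_left)
qed

text \<open>
  After the translation \<open>\<xi> = b + t\<close>, the integral is the convolution at \<open>x - b\<close> of the power being
  integrated with the kernel, and the factor \<open>\<Gamma>(\<kappa>)\<close> of the Beta function cancels against the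
  normalisation of the operator.
\<close>

lemma has_RL_powr:
  assumes \<alpha>: "Re \<alpha> > 0" and \<kappa>: "Re \<kappa> > 0" and x: "b < x"
  shows "has_RL b \<kappa> (\<lambda>\<xi>. of_real (\<xi> - b) powr (\<alpha> - 1)) x
           (Gamma \<alpha> / Gamma (\<alpha> + \<kappa>) * of_real (x - b) powr (\<alpha> + \<kappa> - 1))"
proof -
  let ?g = "\<lambda>t. trunc_powr \<alpha> t * trunc_powr \<kappa> (x - b - t)"
  let ?h = "\<lambda>\<xi>. ?g (- b + 1 * \<xi>)"
  have ker: "(\<lambda>\<xi>. indicator {b<..<x} \<xi> *\<^sub>R
      RL_kernel \<kappa> (\<lambda>\<xi>. of_real (\<xi> - b) powr (\<alpha> - 1)) x \<xi>) = ?h"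
    by (auto simp: fun_eq_iff RL_kernel_def trunc_powr_def indicator_def)
  have "integrable lborel ?h"
    by (rule lborel_integrable_real_affine[OF trunc_powr_convolution_integrable]) (use \<alpha> \<kappa> in auto)
  moreover have "integral\<^sup>L lborel ?h = Beta \<alpha> \<kappa> * of_real (x - b) powr (\<alpha> + \<kappa> - 1)"
  proof -
    have "integral\<^sup>L lborel ?h = integral\<^sup>L lborel ?g"
      using lborel_integral_real_affine[of 1 ?g "- b"] by simp
    also have "\<dots> = Beta \<alpha> \<kappa> * trunc_powr (\<alpha> + \<kappa>) (x - b)"
      by (subst trunc_powr_convolution_scaling) (simp only: Beta_integral_complex[OF \<alpha> \<kappa>])
    finally show ?thesis using x by (simp add: trunc_powr_def)
  qed
  moreover have "?h \<in> borel_measurable lborel" by measurable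
  moreover have "Gamma \<kappa> \<noteq> 0"
    using \<kappa> by (rule Gamma_nonzero_if_Re_pos)
  ultimately show ?thesis
    unfolding has_RL_def RL_exists_def RL_def set_integrable_def set_lebesgue_integral_def ker
    by (simp add: integrable_completion integral_completion Beta_def)
qed

text \<open>
  On a product of a power of \<open>\<tau> - a\<close> and a power of \<open>\<omega> - b\<close> the two partial integrals act
  independently, so the iterated integral of a finite combination is computed termwise.
\<close>

lemma RL_wt_powr_sum:
  fixes A B C :: "'i \<Rightarrow> complex"
  assumes fin: "finite I" and A: "\<And>i. i \<in> I \<Longrightarrow> Re (A i) > 0" and B: "\<And>i. i \<in> I \<Longrightarrow> Re (B i) > 0"
    and l: "Re l > 0" and \<mu>: "Re \<mu> > 0" and w: "b < w" and t: "a < t"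
    and F: "\<And>\<tau> \<omega>. a < \<tau> \<Longrightarrow> b < \<omega> \<Longrightarrow>
      F \<tau> \<omega> = (\<Sum>i\<in>I. C i * of_real (\<tau> - a) powr (A i - 1) * of_real (\<omega> - b) powr (B i - 1))"
  shows "RL_wt_exists b l a \<mu> F t w \<and>
    RL_w b l (RL_t a \<mu> F) t w =
      (\<Sum>i\<in>I. C i * (Gamma (A i) / Gamma (A i + \<mu>)) * (Gamma (B i) / Gamma (B i + l)) *
        of_real (t - a) powr (A i + \<mu> - 1) * of_real (w - b) powr (B i + l - 1))"
proof -
  define D where "D = (\<lambda>i. C i * (Gamma (A i) / Gamma (A i + \<mu>) * of_real (t - a) powr (A i + \<mu> - 1)))"
  have t_int: "has_RL a \<mu> (\<lambda>\<tau>. F \<tau> \<omega>) t (\<Sum>i\<in>I. D i * of_real (\<omega> - b) powr (B i - 1))"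
    if \<omega>: "b < \<omega>" for \<omega>
  proof -
    have "has_RL a \<mu> (\<lambda>\<tau>. \<Sum>i\<in>I. (C i * of_real (\<omega> - b) powr (B i - 1)) * of_real (\<tau> - a) powr (A i - 1)) t
        (\<Sum>i\<in>I. (C i * of_real (\<omega> - b) powr (B i - 1)) *
          (Gamma (A i) / Gamma (A i + \<mu>) * of_real (t - a) powr (A i + \<mu> - 1)))"
      by (intro has_RL_sum has_RL_cmult has_RL_powr fin A \<mu> t)
    also have "(\<Sum>i\<in>I. (C i * of_real (\<omega> - b) powr (B i - 1)) *
          (Gamma (A i) / Gamma (A i + \<mu>) * of_real (t - a) powr (A i + \<mu> - 1))) =
        (\<Sum>i\<in>I. D i * of_real (\<omega> - b) powr (B i - 1))"
      by (intro sum.cong refl) (simp add: D_def)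
    finally show ?thesis
      by (rule iffD2[OF has_RL_cong, rotated]) (simp add: F \<omega> mult_ac)
  qed
  have "has_RL b l (\<lambda>\<omega>. \<Sum>i\<in>I. D i * of_real (\<omega> - b) powr (B i - 1)) w
      (\<Sum>i\<in>I. D i * (Gamma (B i) / Gamma (B i + l) * of_real (w - b) powr (B i + l - 1)))"
    by (intro has_RL_sum has_RL_cmult has_RL_powr fin B l w)
  hence w_int: "has_RL b l (\<lambda>\<omega>. RL_t a \<mu> F t \<omega>) w
      (\<Sum>i\<in>I. D i * (Gamma (B i) / Gamma (B i + l) * of_real (w - b) powr (B i + l - 1)))"
    by (rule iffD2[OF has_RL_cong, rotated]) (use t_int in \<open>simp add: RL_t_def has_RL_def\<close>)
  show ?thesis
    using t_int w_int
    by (auto simp: RL_wt_exists_def RL_w_def has_RL_def D_def mult_ac intro!: sum.cong)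
qed

section \<open>The weighted N-Konhauser polynomials\<close>

text \<open>
  The factor \<open>x\<^bsup>-(s-k)\<^esup>\<close> of the \<open>k\<close>-th summand lowers the exponent \<open>p - s - 1\<close> of the weight to
  \<open>p - 2s + k - 1\<close>. The exponents are left in the form \<open>A - 1\<close> and \<open>B - 1\<close>, where \<open>A\<close> and \<open>B\<close> are the
  arguments of the Gamma function in the coefficient. The parameters \<open>p\<close> and \<open>q\<close> are complex, so that
  the expansion applies before and after the fractional integration.
\<close>

lemma weighted_KN_eq_powr_sum:
  fixes x y y1 y2 :: real
  assumes x: "0 < x" and y: "0 < y"
  shows "of_real x powr (p - of_nat s - 1) * of_real y powr q *
      KN s \<upsilon> p q (of_real (1 / (y1 * x))) (of_real (y2 * y)) =
    (\<Sum>(k, m)\<in>Sigma {0..s} (\<lambda>k. {0..s - k}).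
      Gamma (p - of_nat s) * pochhammer (- of_nat s) (k + m) *
      of_real (1 / y1) ^ (s - k) * of_real y2 ^ (\<upsilon> * m) /
        (Gamma (p - 2 * of_nat s + of_nat k) * Gamma (q + 1 + of_nat (\<upsilon> * m)) * fact k * fact m) *
      of_real x powr (p - 2 * of_nat s + of_nat k - 1) *
      of_real y powr (q + 1 + of_nat (\<upsilon> * m) - 1))"
proof -
  have px: "complex_of_real x powr (p - of_nat s - 1) * of_real (1 / (y1 * x)) ^ (s - k) =
      of_real (1 / y1) ^ (s - k) * of_real x powr (p - 2 * of_nat s + of_nat k - 1)"
    if "k \<le> s" for k
  proof -
    have "complex_of_real x powr (p - of_nat s - 1) =
        of_real x powr ((p - 2 * of_nat s + of_nat k - 1) + of_nat (s - k))"
      using that by (simp add: of_nat_diff algebra_simps)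
    also have "\<dots> = of_real x powr (p - 2 * of_nat s + of_nat k - 1) * of_real x ^ (s - k)"
      using x by (simp only: powr_add) simp
    finally show ?thesis using x by (simp add: power_mult_distrib power_divide)
  qed
  have py: "complex_of_real y powr q * of_real (y2 * y) ^ (\<upsilon> * m) =
      of_real y2 ^ (\<upsilon> * m) * of_real y powr (q + 1 + of_nat (\<upsilon> * m) - 1)" for m
  proof -
    have "complex_of_real y powr (q + 1 + of_nat (\<upsilon> * m) - 1) = of_real y powr (q + of_nat (\<upsilon> * m))"
      by (simp add: algebra_simps)
    also have "\<dots> = of_real y powr q * of_real y ^ (\<upsilon> * m)"
      using y by (simp only: powr_add) (simp del: of_nat_mult)
    finally show ?thesis by (simp add: power_mult_distrib)
  qed
  \<comment> \<open>One summand, with all subterms abstracted: the weights \<open>X\<close>, \<open>Y\<close> are merged with the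
    powers \<open>U\<close>, \<open>V\<close> of the polynomial's arguments.\<close>
  have term_eq: "X * Y * (G * (P * U * V / E)) = G * P * U' * V' / E * X' * Y'"
    if "X * U = U' * X'" "Y * V = V' * Y'" for X Y G P U V E U' V' X' Y' :: complex
  proof -
    have "X * Y * (G * (P * U * V / E)) = G * P * (X * U) * (Y * V) / E" by (simp add: mult_ac)
    also have "\<dots> = G * P * (U' * X') * (V' * Y') / E" by (simp only: that)
    finally show ?thesis by (simp add: mult_ac)
  qed
  show ?thesis
    unfolding KN_def sum.Sigma[OF finite_atLeastAtMost ballI[OF finite_atLeastAtMost]] sum_distrib_left
    by (intro sum.cong refl, clarify) (intro term_eq px py, simp)
qed

theorem theorem36:
  fixes \<upsilon> s :: nat and p q y1 y2 a b t w :: real and l \<mu> :: complex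
  assumes "\<upsilon> \<ge> 1" and "q > -1" and "real s < (p - 1) / 2"
    and "y1 \<noteq> 0" and "w > b" and "t > a"
    and "Re l > 0" and "Re \<mu> > 0"
  shows "let F = (\<lambda>\<tau> \<omega>.
            of_real (\<tau> - a) powr (of_real p - of_nat s - 1) * of_real (\<omega> - b) powr of_real q *
            KN s \<upsilon> (of_real p) (of_real q)
              (of_real (1 / (y1 * (\<tau> - a)))) (of_real (y2 * (\<omega> - b))))
         in RL_wt_exists b l a \<mu> F t w \<and>
            RL_w b l (RL_t a \<mu> F) t w =
              Gamma (of_real p - of_nat s) / Gamma (of_real p + \<mu> - of_nat s) *
              of_real (t - a) powr (of_real p + \<mu> - of_nat s - 1) *
              of_real (w - b) powr (of_real q + l) *
              KN s \<upsilon> (of_real p + \<mu>) (of_real q + l)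
                (of_real (1 / (y1 * (t - a)))) (of_real (y2 * (w - b)))"
proof -
  define I where "I = Sigma {0..s} (\<lambda>k. {0..s - k})"
  define A where "A = (\<lambda>(k, m::nat). complex_of_real p - 2 * of_nat s + of_nat k)"
  define B where "B = (\<lambda>(k::nat, m). complex_of_real q + 1 + of_nat (\<upsilon> * m))"
  \<comment> \<open>The part of the coefficients that the integration leaves unchanged.\<close>
  define N where "N = (\<lambda>(k, m). pochhammer (- of_nat s :: complex) (k + m) *
      of_real (1 / y1) ^ (s - k) * of_real y2 ^ (\<upsilon> * m) / (fact k * fact m))"
  define G where "G = Gamma (complex_of_real p - of_nat s)"
  define G' where "G' = Gamma (complex_of_real p + \<mu> - of_nat s)"
  define F where "F = (\<lambda>\<tau> \<omega>.
            of_real (\<tau> - a) powr (of_real p - of_nat s - 1) * of_real (\<omega> - b) powr of_real q *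
            KN s \<upsilon> (of_real p) (of_real q)
              (of_real (1 / (y1 * (\<tau> - a)))) (of_real (y2 * (\<omega> - b))))"
  have "p - 2 * real s > 0" "p - real s > 0" using assms(3) by auto
  hence A: "Re (A i) > 0" and B: "Re (B i) > 0" for i
    using assms(2) by (auto simp: A_def B_def split: prod.split intro: add_pos_nonneg)
  have G': "G' \<noteq> 0"
    unfolding G'_def using \<open>p - real s > 0\<close> assms(8) by (intro Gamma_nonzero_if_Re_pos) simp
  have expand: "F \<tau> \<omega> = (\<Sum>i\<in>I. G * N i / (Gamma (A i) * Gamma (B i)) *
      of_real (\<tau> - a) powr (A i - 1) * of_real (\<omega> - b) powr (B i - 1))"
    if "a < \<tau>" "b < \<omega>" for \<tau> \<omega>
    unfolding F_def using that
    by (subst weighted_KN_eq_powr_sum)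
       (auto simp: I_def A_def B_def N_def G_def mult_ac intro!: sum.cong)
  have expand': "of_real (t - a) powr (of_real p + \<mu> - of_nat s - 1) *
        of_real (w - b) powr (of_real q + l) *
        KN s \<upsilon> (of_real p + \<mu>) (of_real q + l)
          (of_real (1 / (y1 * (t - a)))) (of_real (y2 * (w - b))) =
      (\<Sum>i\<in>I. G' * N i / (Gamma (A i + \<mu>) * Gamma (B i + l)) *
        of_real (t - a) powr (A i + \<mu> - 1) * of_real (w - b) powr (B i + l - 1))"
    using assms(5,6)
    by (subst weighted_KN_eq_powr_sum)
       (auto simp: I_def A_def B_def N_def G'_def algebra_simps intro!: sum.cong)
  have "RL_wt_exists b l a \<mu> F t w \<and>
    RL_w b l (RL_t a \<mu> F) t w =
      (\<Sum>i\<in>I. G * N i / (Gamma (A i) * Gamma (B i)) *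
        (Gamma (A i) / Gamma (A i + \<mu>)) * (Gamma (B i) / Gamma (B i + l)) *
        of_real (t - a) powr (A i + \<mu> - 1) * of_real (w - b) powr (B i + l - 1))"
    by (rule RL_wt_powr_sum) (use A B assms expand in \<open>auto simp: I_def\<close>)
  also have "(\<Sum>i\<in>I. G * N i / (Gamma (A i) * Gamma (B i)) *
        (Gamma (A i) / Gamma (A i + \<mu>)) * (Gamma (B i) / Gamma (B i + l)) *
        of_real (t - a) powr (A i + \<mu> - 1) * of_real (w - b) powr (B i + l - 1)) =
      G / G' * (\<Sum>i\<in>I. G' * N i / (Gamma (A i + \<mu>) * Gamma (B i + l)) *
        of_real (t - a) powr (A i + \<mu> - 1) * of_real (w - b) powr (B i + l - 1))"
    unfolding sum_distrib_left
    by (intro sum.cong refl) (simp add: Gamma_nonzero_if_Re_pos A B G')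
  finally show ?thesis
    unfolding Let_def expand'[symmetric] F_def[symmetric]
    unfolding G_def G'_def by (simp only: mult.assoc)
qed

end
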